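(* Let $N\geq 1$ and let $W:[0,\infty)\to\mathbb{R}$ be an upper-semicontinuous function such that either $W$ is bounded from above, or there exists $\overline{R}$ such that $W$ is nondecreasing on $[\overline{R},\infty)$. Let $w(x):=W(|x|)$ for $x\in\mathbb{R}^N$. Then the following two conditions are equivalent: (S1) $w$ is a stable potential, i.e. there exists $B\in\mathbb{R}$ such that for all $n$ and all sets of $n$ distinct points $\{x_1,\dots,x_n\}$ in $\mathbb{R}^N$, $$\frac{1}{n^2}\sum_{1\leq i<j\leq n} w(x_i-x_j)\geq -\frac{1}{n}B;$$ (S2) for every probability measure $\mu\in\mathcal{P}(\mathbb{R}^N)$, $E(\mu)\geq 0$, where $$E(\mu)=\int_{\mathbb{R}^N}\int_{\mathbb{R}^N} w(x-y)\,d\mu(x)\,d\mu(y).$$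
   Context: $\mathcal{P}(\mathbb{R}^N)$ denotes the set of Borel probability measures on $\mathbb{R}^N$, and $|\cdot|$ is the Euclidean norm. The energy $E$ is understood as an extended-real-valued integral (it may take infinite values). *)

theory Defs
  imports "HOL-Probability.Probability"
begin

definition usc_on :: "'a::topological_space set \<Rightarrow> ('a \<Rightarrow> real) \<Rightarrow> bool" where
  "usc_on S f \<longleftrightarrow> (\<forall>x\<in>S. \<forall>a>f x. \<forall>\<^sub>F y in at x within S. f y < a)"

text \<open>Potentials are functions on \<open>[0,\<infinity>)\<close>; for \<open>W :: real \<Rightarrow> real\<close> only the values on \<open>{0..}\<close>
  are ever used.\<close>

definition radial :: "(real \<Rightarrow> real) \<Rightarrow> 'a::real_normed_vector \<Rightarrow> real" where
  "radial W x = W (norm x)"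

definition stable_potential :: "('a::real_normed_vector \<Rightarrow> real) \<Rightarrow> bool" where
  "stable_potential w \<longleftrightarrow>
     (\<exists>B::real. \<forall>n::nat. \<forall>x :: nat \<Rightarrow> 'a. n \<ge> 1 \<longrightarrow> inj_on x {1..n} \<longrightarrow>
        1 / (real n)\<^sup>2 * (\<Sum>i\<in>{1..n}. \<Sum>j\<in>{i<..n}. w (x i - x j)) \<ge> - (1 / real n) * B)"

text \<open>The extended-real-valued Lebesgue integral is the difference of the integrals of the positive
  and the negative part (\<open>ennreal\<close> maps negative reals to \<open>0\<close>), and it exists unless both are
  infinite. Existence must be stated separately, because \<open>\<infinity> - \<infinity> = \<infinity>\<close> holds in type \<open>ereal\<close>.\<close>

definition quasi_integrable :: "'a measure \<Rightarrow> ('a \<Rightarrow> real) \<Rightarrow> bool" where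
  "quasi_integrable M f \<longleftrightarrow> f \<in> borel_measurable M \<and>
     ((\<integral>\<^sup>+ x. ennreal (f x) \<partial>M) < \<infinity> \<or> (\<integral>\<^sup>+ x. ennreal (- f x) \<partial>M) < \<infinity>)"

definition ereal_integral :: "'a measure \<Rightarrow> ('a \<Rightarrow> real) \<Rightarrow> ereal" where
  "ereal_integral M f =
     enn2ereal (\<integral>\<^sup>+ x. ennreal (f x) \<partial>M) - enn2ereal (\<integral>\<^sup>+ x. ennreal (- f x) \<partial>M)"

text \<open>The double integral defining the energy is the integral over the product measure.\<close>

definition energy_exists :: "('a::real_normed_vector \<Rightarrow> real) \<Rightarrow> 'a measure \<Rightarrow> bool" where
  "energy_exists w \<mu> \<longleftrightarrow> quasi_integrable (\<mu> \<Otimes>\<^sub>M \<mu>) (\<lambda>(x, y). w (x - y))"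

definition energy :: "('a::real_normed_vector \<Rightarrow> real) \<Rightarrow> 'a measure \<Rightarrow> ereal" where
  "energy w \<mu> = ereal_integral (\<mu> \<Otimes>\<^sub>M \<mu>) (\<lambda>(x, y). w (x - y))"

end

theory Submission
  imports Defs
begin

text \<open>
  Both directions compare a configuration of \<open>n\<close> points with a measure.

  Suppose that energies are nonnegative. The empirical measure of \<open>x\<^sub>1, \<dots>, x\<^sub>n\<close> has energy
  \<open>(n w(0) + 2 \<Sum>\<^bsub>i<j\<^esub> w(x\<^sub>i - x\<^sub>j)) / n\<^sup>2\<close>, because \<open>w\<close> is even and each point also interacts
  with itself. As \<open>w(0)\<close> is a finite number, \<open>B = w(0)/2\<close> is a stability constant.

  Suppose conversely that \<open>w\<close> is stable with constant \<open>B\<close>, and draw \<open>n\<close> independent points with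
  law \<open>\<mu>\<close>. Each pair of them has law \<open>\<mu> \<Otimes> \<mu>\<close>, so that the expectation of the stability
  inequality reads \<open>n (n - 1) / 2 * E(\<mu>) \<ge> - n B\<close>, that is \<open>E(\<mu>) \<ge> - 2 B / (n - 1)\<close>, and \<open>n\<close> is
  arbitrary. This argument needs two supplements. If \<open>\<mu>\<close> has atoms, the random points may coincide, whereas
  stability speaks of distinct points only; upper semicontinuity extends the inequality to all
  configurations, since \<open>w\<close> can hardly increase when coinciding points are pulled apart
  (\<open>stable_sum_lower_bound\<close>). Secondly, the energy must exist: stability for \<open>n = 2\<close>
  bounds \<open>w\<close> from below, so that only the value \<open>+\<infinity>\<close> has to be set apart from the integrable case.
\<close>

section \<open>Sublevel sets of the potential\<close>

lemma usc_on_radial_sublevel_open: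
  fixes W :: "real \<Rightarrow> real"
  assumes "usc_on {0..} W"
  shows "open {x :: 'a::real_normed_vector. radial W x < a}"
proof (rule openI)
  fix x :: 'a
  assume "x \<in> {x. radial W x < a}"
  then have x: "W (norm x) < a"
    by (simp add: radial_def)
  with assms have "\<forall>\<^sub>F r in at (norm x) within {0..}. W r < a"
    unfolding usc_on_def by simp
  then obtain T where T: "open T" "norm x \<in> T"
      "\<And>r. r \<in> T \<Longrightarrow> r \<noteq> norm x \<Longrightarrow> r \<ge> 0 \<Longrightarrow> W r < a"
    unfolding eventually_at_topological by auto
  have "open (norm -` T :: 'a set)"
    using T(1) by (intro open_vimage continuous_intros)
  moreover have "norm -` T \<subseteq> {x :: 'a. radial W x < a}"
    using T(3) x by (auto simp: radial_def) (metis norm_ge_zero)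
  ultimately show "\<exists>e>0. ball x e \<subseteq> {x. radial W x < a}"
    using T(2) by (meson open_contains_ball vimageI subset_trans)
qed

lemma borel_measurable_open_sublevels:
  fixes f :: "'a::topological_space \<Rightarrow> real"
  assumes "\<And>a. open {x. f x < a}"
  shows "f \<in> borel_measurable borel"
  unfolding borel_measurable_iff_less using assms by auto

section \<open>Stability for coinciding points\<close>

lemma stable_potential_iff:
  fixes w :: "'a::real_normed_vector \<Rightarrow> real"
  shows "stable_potential w \<longleftrightarrow>
     (\<exists>B. \<forall>n\<ge>1. \<forall>x. inj_on x {1..n} \<longrightarrow>
        (\<Sum>i\<in>{1..n}. \<Sum>j\<in>{i<..n}. w (x i - x j)) \<ge> - real n * B)"
proof -
  have "(1 / (real n)\<^sup>2 * S \<ge> - (1 / real n) * B) \<longleftrightarrow> (S \<ge> - real n * B)"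
    if "n \<ge> 1" for n :: nat and S B
    using that by (simp add: field_simps power2_eq_square)
  then show ?thesis
    unfolding stable_potential_def by (meson One_nat_def)
qed

text \<open>
  The points \<open>x\<^sub>i\<close> are replaced by \<open>x\<^sub>i + t i v\<close> with a fixed \<open>v \<noteq> 0\<close>. For all small \<open>t > 0\<close>
  these are distinct, and by upper semicontinuity no interaction exceeds its value at \<open>t = 0\<close> by
  more than a prescribed amount.
\<close>

lemma stable_sum_lower_bound:
  fixes w :: "'a::euclidean_space \<Rightarrow> real" and n :: nat
  assumes opn: "\<And>a. open {x. w x < a}"
    and stable: "\<And>x. inj_on x {1..n} \<Longrightarrow> c \<le> (\<Sum>i\<in>{1..n}. \<Sum>j\<in>{i<..n}. w (x i - x j))"
  shows "c \<le> (\<Sum>i\<in>{1..n}. \<Sum>j\<in>{i<..n}. w (x i - x j))"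
proof -
  let ?P = "Sigma {1..n} (\<lambda>i. {i<..n})"
  have fin: "finite ?P"
    by simp
  have as_pairs: "(\<Sum>i\<in>{1..n}. \<Sum>j\<in>{i<..n}. w (z i - z j)) = (\<Sum>(i, j)\<in>?P. w (z i - z j))"
    for z by (subst sum.Sigma) auto
  obtain v :: 'a where v: "v \<noteq> 0"
    using nonempty_Basis nonzero_Basis by blast
  define y where "y t i = x i + (t * real i) *\<^sub>R v" for t i
  have lim: "((\<lambda>t. y t i - y t j) \<longlongrightarrow> x i - x j) (at_right 0)" for i j
    unfolding y_def by (auto intro!: tendsto_eq_intros)
  have apart: "\<forall>\<^sub>F t in at_right 0. y t i \<noteq> y t j" if "i \<noteq> j" for i j
  proof (cases "x i = x j")
    case True
    have "\<forall>\<^sub>F t in at_right (0::real). t > 0"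
      by (simp add: eventually_at_right_less)
    then show ?thesis
      by eventually_elim (use True v that in \<open>auto simp: y_def\<close>)
  next
    case False
    then have "\<forall>\<^sub>F t in at_right 0. y t i - y t j \<noteq> 0"
      by (intro tendsto_imp_eventually_ne[OF lim]) simp
    then show ?thesis
      by simp
  qed
  have "\<forall>\<^sub>F t in at_right 0. \<forall>p\<in>?P. y t (fst p) \<noteq> y t (snd p)"
    using fin by (intro eventually_ball_finite ballI apart) auto
  then have inj: "\<forall>\<^sub>F t in at_right 0. inj_on (y t) {1..n}"
  proof eventually_elim
    case (elim t)
    show ?case
      by (rule linorder_inj_onI') (use elim in force)
  qed
  show ?thesis
  proof (rule field_le_epsilon)
    fix e :: real
    assume e: "e > 0"
    \<comment> \<open>The increments at all pairs add up to at most \<open>e\<close>; the summand \<open>1\<close> covers the case without pairs.\<close>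
    define m where "m = card ?P"
    define d where "d = e / (real m + 1)"
    have d: "d > 0"
      using e by (simp add: d_def add_nonneg_pos)
    have "\<forall>\<^sub>F t in at_right 0. w (y t i - y t j) < w (x i - x j) + d" for i j
      using topological_tendstoD[OF lim opn[of "w (x i - x j) + d"], of i j] d by simp
    then have "\<forall>\<^sub>F t in at_right 0. \<forall>p\<in>?P.
        w (y t (fst p) - y t (snd p)) < w (x (fst p) - x (snd p)) + d"
      using fin by (intro eventually_ball_finite) auto
    with inj have "\<forall>\<^sub>F t in at_right 0. inj_on (y t) {1..n} \<and> (\<forall>p\<in>?P.
        w (y t (fst p) - y t (snd p)) < w (x (fst p) - x (snd p)) + d)"
      by (rule eventually_conj)
    then obtain t where t: "inj_on (y t) {1..n}"
        "\<forall>p\<in>?P. w (y t (fst p) - y t (snd p)) < w (x (fst p) - x (snd p)) + d"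
      using eventually_happens' trivial_limit_at_right_real by blast
    have "c \<le> (\<Sum>(i, j)\<in>?P. w (y t i - y t j))"
      using stable[OF t(1)] unfolding as_pairs .
    also have "\<dots> \<le> (\<Sum>(i, j)\<in>?P. w (x i - x j) + d)"
      using t(2) by (intro sum_mono) (force intro: less_imp_le)
    also have "\<dots> = (\<Sum>(i, j)\<in>?P. w (x i - x j)) + real m * d"
      by (simp add: case_prod_unfold sum.distrib m_def del: card_SigmaI)
    also have "real m * d \<le> e"
      using e by (simp add: d_def field_simps)
    finally show "c \<le> (\<Sum>i\<in>{1..n}. \<Sum>j\<in>{i<..n}. w (x i - x j)) + e"
      unfolding as_pairs by simp
  qed
qed

lemma sum_symmetric_eq_diagonal_plus_twice_upper:
  fixes g :: "nat \<Rightarrow> nat \<Rightarrow> real"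
  assumes "\<And>i j. g i j = g j i"
  shows "(\<Sum>i\<in>{1..n}. \<Sum>j\<in>{1..n}. g i j) =
    (\<Sum>i\<in>{1..n}. g i i) + 2 * (\<Sum>i\<in>{1..n}. \<Sum>j\<in>{i<..n}. g i j)"
proof (induction n)
  case 0
  then show ?case by simp
next
  case (Suc n)
  have "(\<Sum>i\<in>{1..n}. \<Sum>j\<in>{i<..Suc n}. g i j) = (\<Sum>i\<in>{1..n}. (\<Sum>j\<in>{i<..n}. g i j) + g i (Suc n))"
  proof (rule sum.cong[OF refl])
    fix i assume "i \<in> {1..n}"
    then have "{i<..Suc n} = insert (Suc n) {i<..n}"
      by auto
    then show "(\<Sum>j\<in>{i<..Suc n}. g i j) = (\<Sum>j\<in>{i<..n}. g i j) + g i (Suc n)"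
      by simp
  qed
  moreover have "(\<Sum>j\<in>{1..n}. g (Suc n) j) = (\<Sum>j\<in>{1..n}. g j (Suc n))"
    using assms by (intro sum.cong) auto
  ultimately show ?case
    using Suc.IH by (simp add: sum.distrib)
qed

section \<open>Energies as real integrals\<close>

lemma ereal_integral_eq_integral:
  assumes "integrable M f"
  shows "ereal_integral M f = ereal (integral\<^sup>L M f)"
proof -
  have "(\<integral>\<^sup>+ x. ennreal (f x) \<partial>M) < top" "(\<integral>\<^sup>+ x. ennreal (- f x) \<partial>M) < top"
    using assms by (auto simp: real_integrable_def less_top)
  then obtain a b where "a \<ge> 0" "(\<integral>\<^sup>+ x. ennreal (f x) \<partial>M) = ennreal a"
      "b \<ge> 0" "(\<integral>\<^sup>+ x. ennreal (- f x) \<partial>M) = ennreal b"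
    by (metis ennreal_cases less_irrefl)
  then show ?thesis
    unfolding ereal_integral_def real_lebesgue_integral_def[OF assms]
    by (simp add: enn2ereal_ennreal)
qed

section \<open>Independent samples\<close>

text \<open>Two different coordinates of a product of copies of \<open>M\<close> are independent with law \<open>M\<close>.\<close>

lemma distr_PiM_two_components:
  assumes "prob_space M" "i \<in> I" "j \<in> I" "i \<noteq> j"
  shows "distr (PiM I (\<lambda>_. M)) (M \<Otimes>\<^sub>M M) (\<lambda>\<omega>. (\<omega> i, \<omega> j)) = M \<Otimes>\<^sub>M M"
proof (rule sym, rule pair_measure_eqI)
  interpret prob_space M by fact
  show "sigma_finite_measure M" "sigma_finite_measure M"
    by unfold_locales
  show "sets (M \<Otimes>\<^sub>M M) = sets (distr (PiM I (\<lambda>_. M)) (M \<Otimes>\<^sub>M M) (\<lambda>\<omega>. (\<omega> i, \<omega> j)))"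
    by simp
  fix A B
  assume AB: "A \<in> sets M" "B \<in> sets M"
  let ?C = "\<lambda>k. if k = i then A else B"
  have "(\<lambda>\<omega>. (\<omega> i, \<omega> j)) -` (A \<times> B) \<inter> space (PiM I (\<lambda>_. M)) =
      prod_emb I (\<lambda>_. M) {i, j} (Pi\<^sub>E {i, j} ?C)"
    using assms by (auto simp: prod_emb_def space_PiM PiE_iff)
  then have "emeasure (distr (PiM I (\<lambda>_. M)) (M \<Otimes>\<^sub>M M) (\<lambda>\<omega>. (\<omega> i, \<omega> j))) (A \<times> B) =
      emeasure (PiM I (\<lambda>_. M)) (prod_emb I (\<lambda>_. M) {i, j} (Pi\<^sub>E {i, j} ?C))"
    using AB assms by (subst emeasure_distr) auto
  also have "\<dots> = (\<Prod>k\<in>{i, j}. emeasure M (?C k))"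
    using AB assms by (intro emeasure_PiM_emb) auto
  also have "\<dots> = emeasure M A * emeasure M B"
    using assms by simp
  finally show "emeasure M A * emeasure M B =
      emeasure (distr (PiM I (\<lambda>_. M)) (M \<Otimes>\<^sub>M M) (\<lambda>\<omega>. (\<omega> i, \<omega> j))) (A \<times> B)"
    by simp
qed

text \<open>
  The assumed inequality is integrated over \<open>n\<close> independent points with law \<open>M\<close>: each of the
  \<open>n (n - 1) / 2\<close> pairs contributes the same integral, since its law is \<open>M \<Otimes> M\<close>.
\<close>

lemma sample_average_lower_bound:
  fixes f :: "'a \<times> 'a \<Rightarrow> real"
  assumes "prob_space M" and int: "integrable (M \<Otimes>\<^sub>M M) f"
    and lower: "\<And>x. c \<le> (\<Sum>i\<in>{1..n}. \<Sum>j\<in>{i<..n}. f (x i, x j))"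
  shows "c \<le> real n * (real n - 1) / 2 * integral\<^sup>L (M \<Otimes>\<^sub>M M) f"
proof -
  interpret prob_space M by fact
  interpret S: prob_space "PiM {1..n} (\<lambda>_. M)"
    by (intro prob_space_PiM) (rule assms(1))
  let ?S = "PiM {1..n} (\<lambda>_. M)" and ?E = "integral\<^sup>L (M \<Otimes>\<^sub>M M) f"
  have pair: "integrable ?S (\<lambda>\<omega>. f (\<omega> i, \<omega> j))" "(\<integral>\<omega>. f (\<omega> i, \<omega> j) \<partial>?S) = ?E"
    if "i \<in> {1..n}" "j \<in> {i<..n}" for i j
  proof -
    have ij: "i \<in> {1..n}" "j \<in> {1..n}" "i \<noteq> j"
      using that by auto
    have meas: "(\<lambda>\<omega>. (\<omega> i, \<omega> j)) \<in> ?S \<rightarrow>\<^sub>M M \<Otimes>\<^sub>M M"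
      using ij by measurable
    note law = distr_PiM_two_components[OF assms(1) ij]
    show "integrable ?S (\<lambda>\<omega>. f (\<omega> i, \<omega> j))"
      using int by (intro integrable_distr[OF meas]) (simp only: law)
    show "(\<integral>\<omega>. f (\<omega> i, \<omega> j) \<partial>?S) = ?E"
      using integral_distr[OF meas borel_measurable_integrable[OF int]] by (simp only: law)
  qed
  have "c = (\<integral>\<omega>. c \<partial>?S)"
    using S.prob_space by (simp del: One_nat_def)
  also have "\<dots> \<le> (\<integral>\<omega>. (\<Sum>i\<in>{1..n}. \<Sum>j\<in>{i<..n}. f (\<omega> i, \<omega> j)) \<partial>?S)"
    by (intro integral_mono Bochner_Integration.integrable_sum pair lower S.integrable_const) auto
  also have "\<dots> = (\<Sum>i\<in>{1..n}. (\<integral>\<omega>. (\<Sum>j\<in>{i<..n}. f (\<omega> i, \<omega> j)) \<partial>?S))"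
    by (intro Bochner_Integration.integral_sum Bochner_Integration.integrable_sum pair) auto
  also have "\<dots> = (\<Sum>i\<in>{1..n}. \<Sum>j\<in>{i<..n}. (\<integral>\<omega>. f (\<omega> i, \<omega> j) \<partial>?S))"
    by (intro sum.cong refl Bochner_Integration.integral_sum pair) auto
  also have "\<dots> = (\<Sum>i\<in>{1..n}. \<Sum>j\<in>{i<..n}. ?E)"
    by (intro sum.cong refl pair)
  also have "\<dots> = real n * (real n - 1) / 2 * ?E"
    using sum_symmetric_eq_diagonal_plus_twice_upper[of "\<lambda>_ _. ?E" n] by (simp add: algebra_simps)
  finally show ?thesis .
qed

text \<open>
  The bound \<open>m\<close> makes the negative part of the energy finite. If the positive part is infinite the
  energy is \<open>+\<infinity>\<close>; otherwise \<open>w(x - y)\<close> is integrable and averaging over samples applies.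
\<close>

lemma energy_nonneg_of_pair_sum_bounds:
  fixes w :: "'a::euclidean_space \<Rightarrow> real"
  assumes w: "w \<in> borel_measurable borel" and m: "\<And>z. - m \<le> w z"
    and lower: "\<And>n x. n \<ge> 1 \<Longrightarrow> - real n * B \<le> (\<Sum>i\<in>{1..n}. \<Sum>j\<in>{i<..n}. w (x i - x j))"
    and \<mu>: "prob_space \<mu>" "sets \<mu> = sets borel"
  shows "energy_exists w \<mu> \<and> energy w \<mu> \<ge> 0"
proof -
  interpret pair_prob_space \<mu> \<mu>
    using \<mu>(1) by (simp add: pair_prob_space_def pair_sigma_finite_def
        prob_space_imp_sigma_finite)
  let ?P = "\<mu> \<Otimes>\<^sub>M \<mu>" and ?f = "\<lambda>(x, y). w (x - y)"
  have f: "?f \<in> borel_measurable ?P"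
  proof -
    have "?f \<in> borel_measurable (borel \<Otimes>\<^sub>M borel)"
      using w by measurable
    then show ?thesis
      using \<mu>(2) by (simp cong: measurable_cong_sets sets_pair_measure_cong)
  qed
  have "(\<integral>\<^sup>+ p. ennreal (- ?f p) \<partial>?P) \<le> (\<integral>\<^sup>+ p. ennreal m \<partial>?P)"
    using m by (intro nn_integral_mono ennreal_leI) (auto simp: minus_le_iff)
  also have "\<dots> < \<infinity>"
    by (simp add: P.emeasure_space_1)
  finally have neg: "(\<integral>\<^sup>+ p. ennreal (- ?f p) \<partial>?P) < \<infinity>" .
  have "energy w \<mu> \<ge> 0"
  proof (cases "(\<integral>\<^sup>+ p. ennreal (?f p) \<partial>?P) < \<infinity>")
    case False
    then show ?thesis
      unfolding energy_def ereal_integral_def using neg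
      by (simp add: not_less top_unique)
  next
    case True
    with f neg have int: "integrable ?P ?f"
      by (simp add: real_integrable_def less_top)
    let ?E = "integral\<^sup>L ?P ?f"
    \<comment> \<open>A sample of \<open>k + 1\<close> points, with the factor \<open>k + 1\<close> cancelled on both sides.\<close>
    have "- B / real k \<le> ?E / 2" if "k \<ge> 1" for k
    proof -
      have "- real (Suc k) * B \<le> real (Suc k) * (real (Suc k) - 1) / 2 * ?E"
        using \<mu>(1) int lower[of "Suc k"] by (intro sample_average_lower_bound) auto
      then have "real (Suc k) * (- B) \<le> real (Suc k) * (real k * (?E / 2))"
        by (simp add: algebra_simps)
      then have "- B \<le> real k * (?E / 2)"
        by (subst (asm) mult_le_cancel_left_pos) auto
      then show ?thesis
        using that by (simp add: field_simps)
    qed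
    then have "0 \<le> ?E / 2"
      by (intro LIMSEQ_le_const2[OF lim_const_over_n[of "- B"]]) blast
    then show ?thesis
      unfolding energy_def using ereal_integral_eq_integral[OF int] by simp
  qed
  with f neg show ?thesis
    unfolding energy_exists_def quasi_integrable_def by blast
qed

section \<open>Empirical measures\<close>

text \<open>
  The law of \<open>x\<close> under a uniformly chosen index counts coinciding points with multiplicity. The sum
  on the right includes the self-interactions \<open>i = j\<close>.
\<close>

lemma energy_empirical:
  fixes w :: "'a::euclidean_space \<Rightarrow> real" and x :: "nat \<Rightarrow> 'a"
  assumes w: "w \<in> borel_measurable borel" and n: "n \<ge> 1"
  shows "energy w (distr (uniform_count_measure {1..n}) borel x) =
    ereal ((\<Sum>i\<in>{1..n}. \<Sum>j\<in>{1..n}. w (x i - x j)) / (real n)\<^sup>2)"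
proof -
  let ?U = "uniform_count_measure {1..n}" and ?f = "\<lambda>(x, y). w (x - y)"
  let ?g = "\<lambda>(i, j). w (x i - x j)"
  interpret U: prob_space ?U
    using n by (intro prob_space_uniform_count_measure) auto
  interpret UU: pair_prob_space ?U ?U ..
  have x: "x \<in> ?U \<rightarrow>\<^sub>M borel"
    by (simp add: measurable_def space_uniform_count_measure sets_uniform_count_measure)
  have f: "?f \<in> borel_measurable (borel \<Otimes>\<^sub>M borel)"
    using w by measurable
  have xx: "(\<lambda>(i, j). (x i, x j)) \<in> ?U \<Otimes>\<^sub>M ?U \<rightarrow>\<^sub>M borel \<Otimes>\<^sub>M borel"
    using x by measurable
  have "sigma_finite_measure (distr ?U borel x)"
    by (intro prob_space_imp_sigma_finite U.prob_space_distr x)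
  then have law: "distr ?U borel x \<Otimes>\<^sub>M distr ?U borel x =
      distr (?U \<Otimes>\<^sub>M ?U) (borel \<Otimes>\<^sub>M borel) (\<lambda>(i, j). (x i, x j))"
    by (intro pair_measure_distr x)
  have g_meas: "?g \<in> borel_measurable (?U \<Otimes>\<^sub>M ?U)"
    using measurable_compose[OF xx f] by (simp add: case_prod_unfold)
  have g: "integrable (?U \<Otimes>\<^sub>M ?U) ?g"
  proof (rule UU.P.integrable_const_bound[OF _ g_meas])
    have "norm (?g p) \<le> (\<Sum>p\<in>{1..n} \<times> {1..n}. norm (?g p))" if "p \<in> {1..n} \<times> {1..n}" for p
      using that by (intro member_le_sum) auto
    then show "AE p in ?U \<Otimes>\<^sub>M ?U. norm (?g p) \<le> (\<Sum>p\<in>{1..n} \<times> {1..n}. norm (?g p))"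
      by (intro AE_I2) (simp add: space_pair_measure space_uniform_count_measure)
  qed
  have "integrable (distr ?U borel x \<Otimes>\<^sub>M distr ?U borel x) ?f"
    unfolding law using g by (subst integrable_distr_eq[OF xx f]) (simp add: case_prod_unfold)
  then have "energy w (distr ?U borel x) =
      ereal (integral\<^sup>L (distr ?U borel x \<Otimes>\<^sub>M distr ?U borel x) ?f)"
    unfolding energy_def by (rule ereal_integral_eq_integral)
  also have "integral\<^sup>L (distr ?U borel x \<Otimes>\<^sub>M distr ?U borel x) ?f = integral\<^sup>L (?U \<Otimes>\<^sub>M ?U) ?g"
    unfolding law by (subst integral_distr[OF xx f]) (simp add: case_prod_unfold)
  also have "\<dots> = (\<integral>i. (\<integral>j. w (x i - x j) \<partial>?U) \<partial>?U)"
    using UU.integral_fst'[OF g] by simp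
  also have "\<dots> = (\<Sum>i\<in>{1..n}. \<Sum>j\<in>{1..n}. w (x i - x j)) / (real n)\<^sup>2"
    by (simp add: integral_uniform_count_measure sum_divide_distrib[symmetric] power2_eq_square)
  finally show ?thesis .
qed

theorem proposition4p1:
  fixes W :: "real \<Rightarrow> real" and w :: "real ^ 'n \<Rightarrow> real"
  assumes "usc_on {0..} W"
    and "bdd_above (W ` {0..}) \<or> (\<exists>R\<ge>0. mono_on {R..} W)"
    and "w = radial W"
  shows "stable_potential w \<longleftrightarrow>
    (\<forall>\<mu> :: (real ^ 'n) measure. prob_space \<mu> \<longrightarrow> sets \<mu> = sets borel \<longrightarrow>
       energy_exists w \<mu> \<and> energy w \<mu> \<ge> 0)"
proof -
  have opn: "open {x. w x < a}" for a
    unfolding assms(3) by (rule usc_on_radial_sublevel_open[OF assms(1)])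
  have w: "w \<in> borel_measurable borel"
    by (rule borel_measurable_open_sublevels[OF opn])
  show ?thesis
  proof
    assume "stable_potential w"
    then obtain B where B: "\<And>n x. n \<ge> 1 \<Longrightarrow> inj_on x {1..n} \<Longrightarrow>
        - real n * B \<le> (\<Sum>i\<in>{1..n}. \<Sum>j\<in>{i<..n}. w (x i - x j))"
      unfolding stable_potential_iff by blast
    have lower: "- real n * B \<le> (\<Sum>i\<in>{1..n}. \<Sum>j\<in>{i<..n}. w (x i - x j))" if "n \<ge> 1" for n x
      using B[OF that] by (rule stable_sum_lower_bound[OF opn])
    \<comment> \<open>Stability for the two points \<open>z\<close> and \<open>0\<close>.\<close>
    have bound: "- (2 * B) \<le> w z" for z
    proof -
      have "{1..2::nat} = {1, 2}" "{Suc 0<..2} = {2::nat}"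
        by auto
      then show ?thesis
        using lower[of 2 "\<lambda>i. if i = 1 then z else 0"] by simp
    qed
    show "\<forall>\<mu>. prob_space \<mu> \<longrightarrow> sets \<mu> = sets borel \<longrightarrow> energy_exists w \<mu> \<and> energy w \<mu> \<ge> 0"
      using energy_nonneg_of_pair_sum_bounds[OF w bound lower] by blast
  next
    assume nonneg: "\<forall>\<mu>. prob_space \<mu> \<longrightarrow> sets \<mu> = sets borel \<longrightarrow>
        energy_exists w \<mu> \<and> energy w \<mu> \<ge> 0"
    have "- real n * (w 0 / 2) \<le> (\<Sum>i\<in>{1..n}. \<Sum>j\<in>{i<..n}. w (x i - x j))"
      if n: "n \<ge> 1" for n and x :: "nat \<Rightarrow> real ^ 'n"
    proof -
      let ?U = "uniform_count_measure {1..n}"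
      have "prob_space (distr ?U borel x)"
        using n by (intro prob_space.prob_space_distr prob_space_uniform_count_measure)
          (auto simp: measurable_def space_uniform_count_measure sets_uniform_count_measure)
      then have "energy w (distr ?U borel x) \<ge> 0"
        using nonneg by simp
      then have "0 \<le> (\<Sum>i\<in>{1..n}. \<Sum>j\<in>{1..n}. w (x i - x j))"
        unfolding energy_empirical[OF w n] using n by (simp add: zero_le_divide_iff)
      also have "\<dots> = (\<Sum>i\<in>{1..n}. w (x i - x i)) + 2 * (\<Sum>i\<in>{1..n}. \<Sum>j\<in>{i<..n}. w (x i - x j))"
        by (rule sum_symmetric_eq_diagonal_plus_twice_upper)
          (simp add: assms(3) radial_def norm_minus_commute)
      finally show ?thesis
        by simp
    qed
    then show "stable_potential w"
      unfolding stable_potential_iff by blast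
  qed
qed

end
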